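(* Let $A\in\mathbb{C}^{n\times n}$ and $r_0\in\mathbb{C}^n$, and let $V_j$, $V_{j+1}$, $H_j$, $\overline H_j$ be the matrices produced by $j$ steps of the Arnoldi process for $A$ with starting vector $r_0$. Let $\mathcal{U}\subseteq\mathbb{C}^n$ be a $k$-dimensional subspace, $U\in\mathbb{C}^{n\times k}$ a matrix whose columns form a basis of $\mathcal{U}$, and $C:=AU$, with $U^*C$ invertible. For the choice of subspaces $\mathcal{V}_j=\widetilde{\mathcal{V}}_j=\mathcal{K}_j(A,r_0)$ and $\widetilde{\mathcal{U}}=\mathcal{U}$ (with basis matrices $\widetilde V_j=V_j$ and $\widetilde U=U$), the linear system $$\bigl(\widetilde V_j^*(I-\Phi)AV_j\bigr)y_j=\widetilde V_j^*(I-\Phi)r_0,\qquad \Phi:=AU(\widetilde U^*AU)^{-1}\widetilde U^*,$$ for $y_j\in\mathbb{C}^j$ reduces to $$\bigl(H_j-V_j^*C(U^*C)^{-1}U^*V_{j+1}\overline H_j\bigr)y_j=V_j^*\bigl(I-C(U^*C)^{-1}U^*\bigr)r_0 .$$ The coefficient vector $z_j:=(\widetilde U^*AU)^{-1}\widetilde U^*r_0-(\widetilde U^*AU)^{-1}(\widetilde U^*AV_j)y_j\in\mathbb{C}^k$ is then $$z_j=(U^*C)^{-1}U^*r_0-B_jy_j,$$ where $B_j:=(\widetilde U^*AU)^{-1}\widetilde U^*AV_j$.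
   Context: $I$ is the $n\times n$ identity and ${}^*$ denotes conjugate transpose. $\mathcal{K}_j(A,r_0)=\operatorname{span}\{r_0,Ar_0,\dots,A^{j-1}r_0\}$. Arnoldi process: it is assumed to run $j$ steps without breakdown, producing $V_{j+1}=[v_1,\dots,v_{j+1}]\in\mathbb{C}^{n\times(j+1)}$ with orthonormal columns, whose first $j$ columns form $V_j\in\mathbb{C}^{n\times j}$ with range $\mathcal{K}_j(A,r_0)$, and an upper Hessenberg matrix $\overline H_j\in\mathbb{C}^{(j+1)\times j}$, such that $AV_j=V_{j+1}\overline H_j$. The matrix $H_j\in\mathbb{C}^{j\times j}$ is $\overline H_j$ with its last row deleted. Setting: an augmented method approximates the solution of $Ax=b$ by $x_j=x_0+Uz_j+V_jy_j$, where $r_0=b-Ax_0$, with residual orthogonal to $\widetilde{\mathcal{U}}+\widetilde{\mathcal{V}}_j$, where $\widetilde{\mathcal{U}}$ and $\widetilde{\mathcal{V}}_j$ have bases given by the columns of $\widetilde U$ and $\widetilde V_j$; the displayed system for $y_j$ and formula for $z_j$ are the general equations determining these coefficients. "Reduces to" means that, for the stated choices, the coefficient matrices and right-hand sides of the two systems coincide. *)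

theory Defs
  imports
    "Jordan_Normal_Form.Schur_Decomposition"
    "Jordan_Normal_Form.Gauss_Jordan_Elimination"
    "Jordan_Normal_Form.VS_Connect"
begin

notation mat_adjoint ("_\<^sup>H" [1000] 1000)

definition mat_inv :: "complex mat \<Rightarrow> complex mat" where
  "mat_inv M = the (mat_inverse M)"

lemma mat_inv:
  assumes "M \<in> carrier_mat m m" "invertible_mat M"
  shows "mat_inv M \<in> carrier_mat m m" "M * mat_inv M = 1\<^sub>m m" "mat_inv M * M = 1\<^sub>m m"
proof -
  obtain N where N: "M * N = 1\<^sub>m m" "N * M = 1\<^sub>m (dim_row N)"
    using assms by (auto simp: invertible_mat_def inverts_mat_def)
  have "dim_col (M * N) = m" "dim_col (N * M) = dim_row N"
    using N by simp_all
  then have "N \<in> carrier_mat m m"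
    using assms(1) by auto
  then have "M \<in> Units (ring_mat TYPE(complex) m ())"
    using assms(1) N by (auto simp: Units_def ring_mat_def)
  then obtain N' where "mat_inverse M = Some N'"
    using mat_inverse(1)[OF assms(1), where b = "()"] by (cases "mat_inverse M") auto
  then show "mat_inv M \<in> carrier_mat m m" "M * mat_inv M = 1\<^sub>m m" "mat_inv M * M = 1\<^sub>m m"
    using mat_inverse(2)[OF assms(1)] by (auto simp: mat_inv_def)
qed

abbreviation cspace :: "nat \<Rightarrow> (complex, complex vec) module" where
  "cspace n \<equiv> module_vec TYPE(complex) n"

abbreviation cspan :: "nat \<Rightarrow> complex vec set \<Rightarrow> complex vec set" where
  "cspan n \<equiv> LinearCombinations.module.span class_ring (cspace n)"

definition subspace_of_dim :: "nat \<Rightarrow> nat \<Rightarrow> complex vec set \<Rightarrow> bool" where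
  "subspace_of_dim n k W \<longleftrightarrow>
     VectorSpace.subspace class_ring W (cspace n) \<and>
     vectorspace.fin_dim class_ring ((cspace n)\<lparr>carrier := W\<rparr>) \<and>
     vectorspace.dim class_ring ((cspace n)\<lparr>carrier := W\<rparr>) = k"

definition basis_matrix :: "nat \<Rightarrow> nat \<Rightarrow> complex mat \<Rightarrow> complex vec set \<Rightarrow> bool" where
  "basis_matrix n k M W \<longleftrightarrow>
     M \<in> carrier_mat n k \<and>
     distinct (cols M) \<and>
     \<not> LinearCombinations.module.lin_dep class_ring (cspace n) (set (cols M)) \<and>
     cspan n (set (cols M)) = W"

definition krylov :: "nat \<Rightarrow> nat \<Rightarrow> complex mat \<Rightarrow> complex vec \<Rightarrow> complex vec set" where
  "krylov n j A r = cspan n ((\<lambda>i. (A ^\<^sub>m i) *\<^sub>v r) ` {..<j})"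

definition orthonormal_cols :: "complex mat \<Rightarrow> bool" where
  "orthonormal_cols M \<longleftrightarrow>
     (\<forall>i < dim_col M. \<forall>l < dim_col M. col M i \<bullet>c col M l = (if i = l then 1 else 0))"

definition upper_hessenberg :: "complex mat \<Rightarrow> bool" where
  "upper_hessenberg M \<longleftrightarrow>
     (\<forall>i < dim_row M. \<forall>l < dim_col M. l + 1 < i \<longrightarrow> M $$ (i, l) = 0)"

definition leading_block :: "nat \<Rightarrow> nat \<Rightarrow> complex mat \<Rightarrow> complex mat" where
  "leading_block p q M = mat p q (\<lambda>(i, l). M $$ (i, l))"

text \<open>The matrices \<open>V = V\<^bsub>j+1\<^esub>\<close> and \<open>Hbar\<close> that \<open>j\<close> steps of the Arnoldi process produce from
  \<open>A\<close> and \<open>r\<close> when no breakdown occurs. The process enters through the properties of its output,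
  not through one particular orthogonalisation algorithm.\<close>

definition arnoldi ::
  "nat \<Rightarrow> complex mat \<Rightarrow> complex vec \<Rightarrow> nat \<Rightarrow> complex mat \<Rightarrow> complex mat \<Rightarrow> bool" where
  "arnoldi n A r j V Hbar \<longleftrightarrow>
     V \<in> carrier_mat n (j + 1) \<and>
     orthonormal_cols V \<and>
     cspan n (set (cols (leading_block n j V))) = krylov n j A r \<and>
     Hbar \<in> carrier_mat (j + 1) j \<and>
     upper_hessenberg Hbar \<and>
     A * leading_block n j V = V * Hbar"

text \<open>The general augmented method. The arguments \<open>U\<close>, \<open>V\<close> are the basis matrices of the two search
  spaces, \<open>Ut\<close>, \<open>Vt\<close> those of the two test spaces (written with a tilde on paper).\<close>

definition aug_Phi :: "complex mat \<Rightarrow> complex mat \<Rightarrow> complex mat \<Rightarrow> complex mat" where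
  "aug_Phi A U Ut = A * U * mat_inv (Ut\<^sup>H * A * U) * Ut\<^sup>H"

definition aug_coeff ::
  "complex mat \<Rightarrow> complex mat \<Rightarrow> complex mat \<Rightarrow> complex mat \<Rightarrow> complex mat \<Rightarrow> complex mat" where
  "aug_coeff A U Ut V Vt = Vt\<^sup>H * (1\<^sub>m (dim_row A) - aug_Phi A U Ut) * A * V"

definition aug_rhs ::
  "complex mat \<Rightarrow> complex mat \<Rightarrow> complex mat \<Rightarrow> complex mat \<Rightarrow> complex vec \<Rightarrow> complex vec" where
  "aug_rhs A U Ut Vt r = (Vt\<^sup>H * (1\<^sub>m (dim_row A) - aug_Phi A U Ut)) *\<^sub>v r"

definition aug_z ::
  "complex mat \<Rightarrow> complex mat \<Rightarrow> complex mat \<Rightarrow> complex mat \<Rightarrow> complex vec \<Rightarrow> complex vec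
     \<Rightarrow> complex vec" where
  "aug_z A U Ut V r y =
     (mat_inv (Ut\<^sup>H * A * U) * Ut\<^sup>H) *\<^sub>v r
     - (mat_inv (Ut\<^sup>H * A * U) * (Ut\<^sup>H * A * V)) *\<^sub>v y"

definition aug_B :: "complex mat \<Rightarrow> complex mat \<Rightarrow> complex mat \<Rightarrow> complex mat \<Rightarrow> complex mat" where
  "aug_B A U Ut V = mat_inv (Ut\<^sup>H * A * U) * Ut\<^sup>H * A * V"

end

theory Submission
  imports Defs
begin

text \<open>Two observations carry the result. With \<open>Ut = U\<close> and \<open>C = A U\<close>, associativity turns the
  small matrix \<open>U\<^sup>H A U\<close> into \<open>U\<^sup>H C\<close>, so that \<open>\<Phi>\<close> becomes \<open>C (U\<^sup>H C)\<inverse> U\<^sup>H\<close>; this settles the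
  right-hand side and the formula for \<open>z\<^sub>j\<close>. In the coefficient matrix
  \<open>V\<^sub>j\<^sup>H A V\<^sub>j - V\<^sub>j\<^sup>H \<Phi> A V\<^sub>j\<close> the Arnoldi relation replaces \<open>A V\<^sub>j\<close> by \<open>V\<^bsub>j+1\<^esub> Hbar\<close>. In the second
  term this already gives the claimed expression. In the first term orthonormality makes
  \<open>V\<^sub>j\<^sup>H V\<^bsub>j+1\<^esub>\<close> the identity with a zero column appended, and multiplication by that matrix deletes
  the last row of \<open>Hbar\<close>, which leaves \<open>H\<close> (lemma \<open>arnoldi_projection\<close>).\<close>

lemma leading_block_carrier [simp]: "leading_block p q M \<in> carrier_mat p q"
  by (simp add: leading_block_def)

lemma col_leading_block:
  assumes "M \<in> carrier_mat n m" "i < q" "q \<le> m"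
  shows "col (leading_block n q M) i = col M i"
  using assms by (auto simp: leading_block_def)

lemma mat_adjoint_carrier:
  assumes "M \<in> carrier_mat n m"
  shows "M\<^sup>H \<in> carrier_mat m n"
  using assms by (auto simp: mat_adjoint_def)

lemma row_mat_adjoint:
  assumes "M \<in> carrier_mat n m" "i < m"
  shows "row (M\<^sup>H) i = conjugate (col M i)"
proof -
  have "map conjugate (cols M) ! i = conjugate (col M i)"
    using assms by simp
  moreover have "conjugate (col M i) \<in> carrier_vec n"
    using assms by (simp add: col_carrier_vec)
  ultimately show ?thesis
    using assms by (simp add: mat_adjoint_def)
qed

lemma adjoint_leading_block_mult:
  assumes V: "V \<in> carrier_mat n m" and orth: "orthonormal_cols V" and p: "p \<le> m"
  shows "(leading_block n p V)\<^sup>H * V = leading_block p m (1\<^sub>m m)"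
proof (rule eq_matI)
  have adj: "(leading_block n p V)\<^sup>H \<in> carrier_mat p n"
    by (rule mat_adjoint_carrier) simp
  show "dim_row ((leading_block n p V)\<^sup>H * V) = dim_row (leading_block p m (1\<^sub>m m))"
    "dim_col ((leading_block n p V)\<^sup>H * V) = dim_col (leading_block p m (1\<^sub>m m))"
    using adj V by (auto simp: leading_block_def)
  fix i l
  assume "i < dim_row (leading_block p m (1\<^sub>m m :: complex mat))"
    and "l < dim_col (leading_block p m (1\<^sub>m m :: complex mat))"
  then have il: "i < p" "l < m" by (simp_all add: leading_block_def)
  have "row ((leading_block n p V)\<^sup>H) i = conjugate (col V i)"
    using row_mat_adjoint[of "leading_block n p V" n p i] col_leading_block[OF V il(1) p] il
    by simp
  then have "((leading_block n p V)\<^sup>H * V) $$ (i, l) = conjugate (col V i) \<bullet> col V l"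
    using il adj V by simp
  also have "\<dots> = col V l \<bullet>c col V i"
    using V by (intro comm_scalar_prod[where n = n]) (auto intro: carrier_vecI)
  also have "\<dots> = leading_block p m (1\<^sub>m m) $$ (i, l)"
    using orth V il p by (auto simp: orthonormal_cols_def leading_block_def)
  finally show "((leading_block n p V)\<^sup>H * V) $$ (i, l) = leading_block p m (1\<^sub>m m) $$ (i, l)" .
qed

lemma leading_block_one_mult:
  assumes M: "M \<in> carrier_mat m q" and p: "p \<le> m"
  shows "leading_block p m (1\<^sub>m m) * M = leading_block p q M"
proof (rule eq_matI)
  fix i l
  assume "i < dim_row (leading_block p q M)" and "l < dim_col (leading_block p q M)"
  then have il: "i < p" "l < q" by (simp_all add: leading_block_def)
  have "row (leading_block p m (1\<^sub>m m)) i = (unit_vec m i :: complex vec)"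
    using il p by (intro eq_vecI) (auto simp: leading_block_def)
  then have "(leading_block p m (1\<^sub>m m) * M) $$ (i, l) = unit_vec m i \<bullet> col M l"
    using il M by (simp add: leading_block_def)
  then show "(leading_block p m (1\<^sub>m m) * M) $$ (i, l) = leading_block p q M $$ (i, l)"
    using il p M by (simp add: leading_block_def)
qed (use M in \<open>auto simp: leading_block_def\<close>)

text \<open>The compression of \<open>A\<close> to the Krylov space is represented by the square Hessenberg matrix.
  The last Arnoldi vector drops out because it is orthogonal to all earlier ones.\<close>

lemma arnoldi_projection:
  assumes "arnoldi n A r j V Hbar"
  shows "(leading_block n j V)\<^sup>H * (V * Hbar) = leading_block j j Hbar"
proof -
  have V: "V \<in> carrier_mat n (j + 1)" "orthonormal_cols V" "Hbar \<in> carrier_mat (j + 1) j"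
    using assms by (auto simp: arnoldi_def)
  have adj: "(leading_block n j V)\<^sup>H \<in> carrier_mat j n"
    by (rule mat_adjoint_carrier) simp
  have "(leading_block n j V)\<^sup>H * (V * Hbar) = (leading_block n j V)\<^sup>H * V * Hbar"
    using assoc_mult_mat[OF adj V(1,3)] by simp
  then show ?thesis
    using adjoint_leading_block_mult[OF V(1,2), of j] leading_block_one_mult[OF V(3), of j]
    by simp
qed

theorem proposition4p3:
  fixes n k j :: nat
    and A Vj1 Vj H Hbar U C Ut Vt B :: "complex mat"
    and r0 :: "complex vec"
    and \<U> :: "complex vec set"
  assumes "A \<in> carrier_mat n n"
    and "r0 \<in> carrier_vec n"
    and "arnoldi n A r0 j Vj1 Hbar"
    and "Vj = leading_block n j Vj1"
    and "H = leading_block j j Hbar"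
    and "subspace_of_dim n k \<U>"
    and "basis_matrix n k U \<U>"
    and "C = A * U"
    and "invertible_mat (U\<^sup>H * C)"
    and "Ut = U"
    and "Vt = Vj"
    and "B = aug_B A U Ut Vj"
  shows "aug_coeff A U Ut Vj Vt
           = H - Vj\<^sup>H * C * mat_inv (U\<^sup>H * C) * U\<^sup>H * Vj1 * Hbar
       \<and> aug_rhs A U Ut Vt r0
           = (Vj\<^sup>H * (1\<^sub>m n - C * mat_inv (U\<^sup>H * C) * U\<^sup>H)) *\<^sub>v r0
       \<and> (\<forall>y \<in> carrier_vec j.
            aug_z A U Ut Vj r0 y = (mat_inv (U\<^sup>H * C) * U\<^sup>H) *\<^sub>v r0 - B *\<^sub>v y)"
proof -
  note A = assms(1)
  have U: "U \<in> carrier_mat n k" using assms(7) by (simp add: basis_matrix_def)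
  have Uh: "U\<^sup>H \<in> carrier_mat k n" using U by (rule mat_adjoint_carrier)
  have C: "C \<in> carrier_mat n k" using A U assms(8) by simp
  define G where "G = mat_inv (U\<^sup>H * C)"
  have G: "G \<in> carrier_mat k k"
    unfolding G_def using Uh C assms(9) by (intro mat_inv(1)) auto
  have UAU: "U\<^sup>H * A * U = U\<^sup>H * C"
    using assoc_mult_mat[OF Uh A U] assms(8) by simp
  have V: "Vj1 \<in> carrier_mat n (j + 1)" "Hbar \<in> carrier_mat (j + 1) j" "A * Vj = Vj1 * Hbar"
    using assms(3,4) by (auto simp: arnoldi_def)
  have Vj: "Vj \<in> carrier_mat n j" using assms(4) by simp
  have Vh: "Vj\<^sup>H \<in> carrier_mat j n" using Vj by (rule mat_adjoint_carrier)
  have Phi: "aug_Phi A U Ut = C * G * U\<^sup>H"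
    using UAU assms(8,10) by (simp add: aug_Phi_def G_def)
  let ?P = "C * G * U\<^sup>H"
  have P: "?P \<in> carrier_mat n n" using C G Uh by simp
  have W: "Vj1 * Hbar \<in> carrier_mat n j" using V by simp
  have VhP: "Vj\<^sup>H * ?P = Vj\<^sup>H * C * G * U\<^sup>H"
    using assoc_mult_mat[OF Vh, of "C * G" k "U\<^sup>H" n] assoc_mult_mat[OF Vh C G] C G Uh
    by (metis mult_carrier_mat)
  have "aug_coeff A U Ut Vj Vt = Vj\<^sup>H * (1\<^sub>m n - ?P) * A * Vj"
    using A assms(11) by (simp add: aug_coeff_def Phi)
  also have "\<dots> = Vj\<^sup>H * (1\<^sub>m n - ?P) * (Vj1 * Hbar)"
    using assoc_mult_mat[of "Vj\<^sup>H * (1\<^sub>m n - ?P)" j n A n Vj j] A Vj Vh P V(3)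
    by (simp add: minus_carrier_mat)
  also have "Vj\<^sup>H * (1\<^sub>m n - ?P) = Vj\<^sup>H - Vj\<^sup>H * ?P"
    using mult_minus_distrib_mat[OF Vh one_carrier_mat P] Vh by simp
  also have "(Vj\<^sup>H - Vj\<^sup>H * ?P) * (Vj1 * Hbar)
      = Vj\<^sup>H * (Vj1 * Hbar) - Vj\<^sup>H * ?P * (Vj1 * Hbar)"
    using Vh P W by (intro minus_mult_distrib_mat) auto
  also have "Vj\<^sup>H * (Vj1 * Hbar) = H"
    using arnoldi_projection[OF assms(3)] assms(4,5) by simp
  also have "Vj\<^sup>H * ?P * (Vj1 * Hbar) = Vj\<^sup>H * C * G * U\<^sup>H * Vj1 * Hbar"
    unfolding VhP using Vh C G Uh V(1,2)
    by (intro assoc_mult_mat[symmetric]) auto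
  finally have coeff: "aug_coeff A U Ut Vj Vt = H - Vj\<^sup>H * C * G * U\<^sup>H * Vj1 * Hbar" .
  have rhs: "aug_rhs A U Ut Vt r0 = (Vj\<^sup>H * (1\<^sub>m n - ?P)) *\<^sub>v r0"
    using A assms(11) by (simp add: aug_rhs_def Phi)
  have "B = G * U\<^sup>H * A * Vj"
    using assms(10,12) UAU by (simp add: aug_B_def G_def)
  also have "\<dots> = G * (U\<^sup>H * A * Vj)"
    using assoc_mult_mat[OF G Uh A]
      assoc_mult_mat[OF G mult_carrier_mat[OF Uh A] Vj] by metis
  finally have "G * (U\<^sup>H * A * Vj) = B" by simp
  then have z: "aug_z A U Ut Vj r0 y = (G * U\<^sup>H) *\<^sub>v r0 - B *\<^sub>v y" for y
    using assms(10) UAU by (simp add: aug_z_def G_def)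
  show ?thesis
    using coeff rhs z by (simp add: G_def)
qed

end
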